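(* (1) For $\lambda\in[0,1)$, $\mathbb{L}^{>\lambda}(\mathrm{QBA}|\mathrm{D})$ is not closed under intersection. (2) For $\lambda\in[0,1)$, $\mathbb{L}^{>\lambda}(\mathrm{QBA}|\mathrm{D})$ is not closed under complementation (relative to $\Sigma^\omega$).
   Context: A quantum automaton is a tuple $\mathcal{A}=(\mathcal{H},|s_0\rangle,\Sigma,\{U_\sigma:\sigma\in\Sigma\},F)$ where $\mathcal{H}$ is a finite-dimensional complex Hilbert space, $|s_0\rangle$ a unit vector, $\Sigma$ a finite alphabet, each $U_\sigma$ unitary, and $F$ a subspace. For $w=\sigma_1\sigma_2\cdots\in\Sigma^\omega$, a unit vector $|\psi\rangle\in F$ and checkpoints $0\le n_1<n_2<\cdots$, the disturbing run is $|s_0\rangle$ and for $n\ge1$: $|s_n\rangle=U_{\sigma_n}|\psi\rangle$ if $n-1=n_i$ for some $i$, else $|s_n\rangle=U_{\sigma_n}|s_{n-1}\rangle$; $f^{\mathrm{D}}_{\mathcal{A}}(w)=\sup_{|\psi\rangle}\sup_{\{n_i\}}\inf_{i\ge1}|\langle\psi|s_{n_i}\rangle|^2$ over unit $|\psi\rangle\in F$ and strictly increasing checkpoint sequences. $\mathcal{L}^{>\lambda}(\mathcal{A}|\mathrm{D})=\{w:f^{\mathrm{D}}_{\mathcal{A}}(w)>\lambda\}$ and $\mathbb{L}^{>\lambda}(\mathrm{QBA}|\mathrm{D})$ is the class of all such languages over all quantum automata. *)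

theory Defs
  imports "Jordan_Normal_Form.Matrix"
begin

(* Quantum automaton over letters of type nat, Hilbert space C^dim. *)
record qa =
  qa_dim :: nat
  qa_init :: "complex vec"
  qa_U :: "nat \<Rightarrow> complex mat"
  qa_F :: "complex vec set"

definition cadj :: "complex mat \<Rightarrow> complex mat" where
  "cadj U = mat (dim_col U) (dim_row U) (\<lambda>(i,j). cnj (U $$ (j,i)))"

definition unitary_mat :: "nat \<Rightarrow> complex mat \<Rightarrow> bool" where
  "unitary_mat n U \<longleftrightarrow> U \<in> carrier_mat n n \<and> U * cadj U = 1\<^sub>m n \<and> cadj U * U = 1\<^sub>m n"

definition unit_vec_in :: "nat \<Rightarrow> complex vec \<Rightarrow> bool" where
  "unit_vec_in n v \<longleftrightarrow> v \<in> carrier_vec n \<and> v \<bullet>c v = 1"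

definition subspace_of :: "nat \<Rightarrow> complex vec set \<Rightarrow> bool" where
  "subspace_of n F \<longleftrightarrow> F \<subseteq> carrier_vec n \<and> 0\<^sub>v n \<in> F \<and>
     (\<forall>u\<in>F. \<forall>v\<in>F. u + v \<in> F) \<and> (\<forall>c. \<forall>v\<in>F. c \<cdot>\<^sub>v v \<in> F)"

(* A is a quantum automaton over the finite alphabet Sg *)
definition is_qa :: "nat set \<Rightarrow> qa \<Rightarrow> bool" where
  "is_qa Sg A \<longleftrightarrow> finite Sg \<and> unit_vec_in (qa_dim A) (qa_init A) \<and>
     (\<forall>a\<in>Sg. unitary_mat (qa_dim A) (qa_U A a)) \<and> subspace_of (qa_dim A) (qa_F A)"

(* infinite words over Sg: w i is the letter sigma_{i+1} *)
definition omega_words :: "nat set \<Rightarrow> (nat \<Rightarrow> nat) set" where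
  "omega_words Sg = {w. \<forall>i. w i \<in> Sg}"

(* disturbing run; checkpoints n_1 < n_2 < ... are given by strictly monotone ns (ns 0 = n_1) *)
fun drun :: "qa \<Rightarrow> (nat \<Rightarrow> nat) \<Rightarrow> complex vec \<Rightarrow> (nat \<Rightarrow> nat) \<Rightarrow> nat \<Rightarrow> complex vec" where
  "drun A w psi ns 0 = qa_init A"
| "drun A w psi ns (Suc n) =
     qa_U A (w n) *\<^sub>v (if n \<in> range ns then psi else drun A w psi ns n)"

(* |<psi|s>|^2 *)
definition overlap :: "complex vec \<Rightarrow> complex vec \<Rightarrow> real" where
  "overlap psi s = (cmod (s \<bullet>c psi))\<^sup>2"

definition fD_values :: "qa \<Rightarrow> (nat \<Rightarrow> nat) \<Rightarrow> real set" where
  "fD_values A w = {(INF i. overlap psi (drun A w psi ns (ns i))) | psi ns.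
       psi \<in> qa_F A \<and> unit_vec_in (qa_dim A) psi \<and> strict_mono ns}"

(* sup over an empty set is taken to be 0 *)
definition fD :: "qa \<Rightarrow> (nat \<Rightarrow> nat) \<Rightarrow> real" where
  "fD A w = (if fD_values A w = {} then 0 else Sup (fD_values A w))"

definition lang_D :: "nat set \<Rightarrow> real \<Rightarrow> qa \<Rightarrow> (nat \<Rightarrow> nat) set" where
  "lang_D Sg lam A = {w \<in> omega_words Sg. fD A w > lam}"

definition QBA_D_class :: "nat set \<Rightarrow> real \<Rightarrow> (nat \<Rightarrow> nat) set set" where
  "QBA_D_class Sg lam = {lang_D Sg lam A | A. is_qa Sg A}"

end

theory Submission
  imports Defs
begin

text \<open>If \<open>psi\<close> and checkpoints \<open>n\<^sub>1 < n\<^sub>2 < \<dots>\<close> witness that \<open>w\<close> is accepted, then so is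
  the word that follows \<open>w\<close> up to \<open>n\<^sub>1\<close> and then repeats an arbitrary letter \<open>c\<close> forever: by
  pigeonhole the orbit \<open>U\<^sub>c\<^sup>j psi\<close> returns arbitrarily close to \<open>psi\<close>, say at \<open>j = k\<close>, and
  the checkpoints \<open>n\<^sub>1, n\<^sub>1 + k, n\<^sub>1 + 2k, \<dots>\<close> see either the original state at \<open>n\<^sub>1\<close> or
  \<open>U\<^sub>c\<^sup>k psi\<close>. So every language of the class containing \<open>w\<close> contains some \<open>w[0, n) c\<^sup>\<omega>\<close>.

  Over \<open>{0, 1}\<close> let letter \<open>1\<close> swap the basis states of \<open>\<complex>\<^sup>2\<close>, let \<open>0\<close> act trivially and
  take \<open>F = span e\<^sub>0\<close>. Started in \<open>e\<^sub>0\<close> and in \<open>e\<^sub>1\<close>, both automata accept \<open>1\<^sup>\<omega>\<close>, but each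
  \<open>1\<^sup>n 0\<^sup>\<omega>\<close> is rejected by one of them, so their intersection is not in the class. Likewise
  \<open>1 0\<^sup>\<omega>\<close> lies in the complement of the first language, while every \<open>w[0, n) 1\<^sup>\<omega>\<close> is
  accepted by it.\<close>

section \<open>Unitary evolution\<close>

lemma conjugate_mult_mat_vec:
  fixes A :: "complex mat"
  assumes "A \<in> carrier_mat n n" and "v \<in> carrier_vec n"
  shows "conjugate (A *\<^sub>v v) = transpose_mat (cadj A) *\<^sub>v conjugate v"
  using assms by (intro eq_vecI) (auto simp: cadj_def scalar_prod_def)

lemma cscalar_prod_unitary:
  assumes U: "unitary_mat n U" and x: "x \<in> carrier_vec n" and y: "y \<in> carrier_vec n"
  shows "(U *\<^sub>v x) \<bullet>c (U *\<^sub>v y) = x \<bullet>c y"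
proof -
  have Uc: "U \<in> carrier_mat n n" and adj_U: "cadj U * U = 1\<^sub>m n"
    using U by (auto simp: unitary_mat_def)
  have adj_c: "cadj U \<in> carrier_mat n n" using Uc by (simp add: cadj_def)
  have "(U *\<^sub>v x) \<bullet>c (U *\<^sub>v y) = (transpose_mat (cadj U) *\<^sub>v conjugate y) \<bullet> (U *\<^sub>v x)"
    using Uc adj_c x y
    by (simp add: conjugate_mult_mat_vec comm_scalar_prod[of "U *\<^sub>v x" n])
  also have "\<dots> = conjugate y \<bullet> ((cadj U * U) *\<^sub>v x)"
    using Uc adj_c x y by (simp add: transpose_vec_mult_scalar[OF adj_c])
  also have "\<dots> = x \<bullet>c y"
    using x y by (simp add: adj_U comm_scalar_prod[of _ n])
  finally show ?thesis .
qed

lemma unit_vec_in_unitary: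
  assumes "unitary_mat n U" and "unit_vec_in n x"
  shows "unit_vec_in n (U *\<^sub>v x)"
  using assms cscalar_prod_unitary[OF assms(1), of x x]
  by (auto simp: unit_vec_in_def unitary_mat_def)

lemma unit_vec_in_funpow_unitary:
  assumes "unitary_mat n V" and "unit_vec_in n x"
  shows "unit_vec_in n (((*\<^sub>v) V ^^ k) x)"
  by (induction k) (simp_all add: assms unit_vec_in_unitary)

lemma cscalar_prod_funpow_unitary:
  assumes V: "unitary_mat n V" and x: "unit_vec_in n x"
  shows "((*\<^sub>v) V ^^ (i + d)) x \<bullet>c ((*\<^sub>v) V ^^ i) x = ((*\<^sub>v) V ^^ d) x \<bullet>c x"
proof (induction i)
  case (Suc i)
  have "\<And>k. ((*\<^sub>v) V ^^ k) x \<in> carrier_vec n"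
    using unit_vec_in_funpow_unitary[OF V x] by (simp add: unit_vec_in_def)
  then show ?case using Suc by (simp add: cscalar_prod_unitary[OF V])
qed simp

lemma cscalar_prod_self_eq_sum:
  assumes "v \<in> carrier_vec n"
  shows "v \<bullet>c v = complex_of_real (\<Sum>t<n. (cmod (v $ t))\<^sup>2)"
  using assms unfolding scalar_prod_def of_real_sum
  by (auto simp: atLeast0LessThan simp del: complex_mult_cnj intro!: sum.cong)
    (metis complex_norm_square of_real_power)

lemma unit_vec_in_index_le_1:
  assumes "unit_vec_in n v" and "t < n"
  shows "cmod (v $ t) \<le> 1"
proof -
  have "(\<Sum>t<n. (cmod (v $ t))\<^sup>2) = 1"
    using assms cscalar_prod_self_eq_sum[of v n] unfolding unit_vec_in_def
    by (metis of_real_eq_1_iff)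
  moreover have "(cmod (v $ t))\<^sup>2 \<le> (\<Sum>t<n. (cmod (v $ t))\<^sup>2)"
    using assms(2) by (intro member_le_sum) auto
  ultimately show ?thesis by (simp add: power_le_one_iff abs_le_square_iff)
qed

lemma cmod_cscalar_prod_le:
  assumes "u \<in> carrier_vec n" and "v \<in> carrier_vec n"
    and u_le: "\<And>t. t < n \<Longrightarrow> cmod (u $ t) \<le> a" and v_le: "\<And>t. t < n \<Longrightarrow> cmod (v $ t) \<le> b"
  shows "cmod (u \<bullet>c v) \<le> n * a * b"
proof -
  have "cmod (u \<bullet>c v) = cmod (\<Sum>t<n. u $ t * cnj (v $ t))"
    using assms(1,2) by (simp add: scalar_prod_def lessThan_atLeast0)
  also have "\<dots> \<le> (\<Sum>t<n. cmod (u $ t) * cmod (v $ t))"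
    by (rule norm_sum[THEN order_trans]) (simp add: norm_mult)
  also have "\<dots> \<le> (\<Sum>t<n. a * b)"
    using u_le v_le by (intro sum_mono mult_mono) (auto intro: order_trans[OF norm_ge_zero])
  finally show ?thesis by simp
qed

lemma overlap_nonneg: "0 \<le> overlap psi s"
  by (simp add: overlap_def)

lemma overlap_le_dim_squared:
  assumes "unit_vec_in n s" and "unit_vec_in n psi"
  shows "overlap psi s \<le> (real n)\<^sup>2"
proof -
  have "cmod (s \<bullet>c psi) \<le> real n * 1 * 1"
    using assms by (intro cmod_cscalar_prod_le) (auto simp: unit_vec_in_def unit_vec_in_index_le_1)
  then show ?thesis unfolding overlap_def by (simp add: power_mono)
qed

section \<open>Recurrence of unitary orbits\<close>

lemma abs_diff_less_if_floor_mult_eq: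
  fixes x y M :: real
  assumes "\<lfloor>x * M\<rfloor> = \<lfloor>y * M\<rfloor>" and "M > 0"
  shows "\<bar>x - y\<bar> < 1 / M"
proof -
  have "\<bar>x * M - y * M\<bar> < 1"
    using assms(1) floor_eq_iff[of "x * M"] floor_eq_iff[of "y * M"] by linarith
  then have "\<bar>x - y\<bar> * M < 1" using assms(2) by (simp add: abs_mult flip: left_diff_distrib)
  then show ?thesis using assms(2) by (simp add: field_simps)
qed

lemma floor_mult_in_range:
  fixes x M :: real
  assumes "\<bar>x\<bar> \<le> 1" and "M > 0"
  shows "\<lfloor>x * M\<rfloor> \<in> {-\<lceil>M\<rceil>..\<lceil>M\<rceil>}"
proof -
  have "-M \<le> x * M" "x * M \<le> M"
    using assms mult_right_mono[of "-1" x M] mult_right_mono[of x 1 M] by auto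
  then have "\<lfloor>-M\<rfloor> \<le> \<lfloor>x * M\<rfloor>" "\<lfloor>x * M\<rfloor> \<le> \<lfloor>M\<rfloor>" by (auto intro: floor_mono)
  moreover have "\<lfloor>-M\<rfloor> = -\<lceil>M\<rceil>" by (simp add: ceiling_def)
  ultimately show ?thesis using floor_le_ceiling[of M] by (simp; linarith)
qed

text \<open>Pigeonhole on the finitely many grid cells of mesh \<open>1/M\<close> that meet the unit ball.\<close>

lemma unit_vec_seq_close_pair:
  fixes W :: "nat \<Rightarrow> complex vec"
  assumes unit: "\<And>j. unit_vec_in n (W j)" and eta: "eta > 0"
  shows "\<exists>i j. i < j \<and> (\<forall>t<n. cmod (W j $ t - W i $ t) < eta)"
proof -
  define M where "M = 2 / eta"
  have M: "M > 0" using eta by (simp add: M_def)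
  define S where "S = {-\<lceil>M\<rceil>..\<lceil>M\<rceil>} \<times> {-\<lceil>M\<rceil>..\<lceil>M\<rceil>}"
  define cell where
    "cell v = map (\<lambda>t. (\<lfloor>Re (v $ t) * M\<rfloor>, \<lfloor>Im (v $ t) * M\<rfloor>)) [0..<n]" for v :: "complex vec"
  have cells: "cell (W j) \<in> {xs. set xs \<subseteq> S \<and> length xs = n}" for j
  proof -
    have "(\<lfloor>Re (W j $ t) * M\<rfloor>, \<lfloor>Im (W j $ t) * M\<rfloor>) \<in> S" if "t < n" for t
    proof -
      have "cmod (W j $ t) \<le> 1" by (rule unit_vec_in_index_le_1[OF unit that])
      then have "\<bar>Re (W j $ t)\<bar> \<le> 1" "\<bar>Im (W j $ t)\<bar> \<le> 1"
        using abs_Re_le_cmod[of "W j $ t"] abs_Im_le_cmod[of "W j $ t"] by linarith+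
      then show ?thesis unfolding S_def using floor_mult_in_range[OF _ M] by blast
    qed
    then show ?thesis by (auto simp: cell_def)
  qed
  have "finite S" by (simp add: S_def)
  moreover have "range (\<lambda>j. cell (W j)) \<subseteq> {xs. set xs \<subseteq> S \<and> length xs = n}"
    using cells by blast
  ultimately have "finite (range (\<lambda>j. cell (W j)))"
    by (rule finite_subset[OF _ finite_lists_length_eq, rotated])
  then have "\<not> inj (\<lambda>j. cell (W j))"
    using finite_imageD[of "\<lambda>j. cell (W j)" UNIV] by auto
  then obtain a b where "a \<noteq> b" "cell (W a) = cell (W b)" unfolding inj_def by blast
  then obtain i j where ij: "i < j" "cell (W i) = cell (W j)"
    by (cases a b rule: linorder_cases) auto
  have "cmod (W j $ t - W i $ t) < eta" if t: "t < n" for t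
  proof -
    have "\<lfloor>Re (W j $ t) * M\<rfloor> = \<lfloor>Re (W i $ t) * M\<rfloor>" "\<lfloor>Im (W j $ t) * M\<rfloor> = \<lfloor>Im (W i $ t) * M\<rfloor>"
      using arg_cong[OF ij(2), of "\<lambda>xs. xs ! t"] t by (simp_all add: cell_def)
    then have "\<bar>Re (W j $ t) - Re (W i $ t)\<bar> < 1 / M" "\<bar>Im (W j $ t) - Im (W i $ t)\<bar> < 1 / M"
      using abs_diff_less_if_floor_mult_eq[OF _ M] by blast+
    moreover have "1 / M + 1 / M = eta" by (simp add: M_def)
    moreover have "cmod (W j $ t - W i $ t) \<le> \<bar>Re (W j $ t) - Re (W i $ t)\<bar> + \<bar>Im (W j $ t) - Im (W i $ t)\<bar>"
      using cmod_le[of "W j $ t - W i $ t"] by simp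
    ultimately show ?thesis by linarith
  qed
  then show ?thesis using ij(1) by blast
qed

lemma less_cmod_squared_if_near_1:
  fixes z :: complex
  assumes "0 \<le> lam" and "lam < 1" and "cmod (z - 1) \<le> (1 - lam) / 2"
  shows "lam < (cmod z)\<^sup>2"
proof -
  have "(1 + lam) / 2 \<le> cmod z"
    using assms(3) norm_triangle_ineq2[of 1 z] norm_minus_commute[of 1 z] by (simp add: field_simps)
  then have "((1 + lam) / 2)\<^sup>2 \<le> (cmod z)\<^sup>2"
    using assms(1) by (intro power_mono) simp_all
  moreover have "0 < ((1 - lam) / 2)\<^sup>2" using assms(2) by simp
  then have "lam < ((1 + lam) / 2)\<^sup>2" by (simp add: power2_eq_square field_simps)
  ultimately show ?thesis by linarith
qed

lemma unitary_recurrence: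
  assumes V: "unitary_mat n V" and psi: "unit_vec_in n psi" and lam: "lam < 1"
  shows "\<exists>k\<ge>1. lam < overlap psi (((*\<^sub>v) V ^^ k) psi)"
proof (cases "lam < 0")
  case True
  then show ?thesis using overlap_nonneg by (meson le_refl less_le_trans)
next
  case False
  define W where "W j = ((*\<^sub>v) V ^^ j) psi" for j
  have W_unit: "unit_vec_in n (W j)" for j
    unfolding W_def by (rule unit_vec_in_funpow_unitary[OF V psi])
  have W_carrier: "W j \<in> carrier_vec n" for j
    using W_unit by (simp add: unit_vec_in_def)
  define eta where "eta = (1 - lam) / (2 * (real n + 1))"
  have eta: "eta > 0" using lam by (simp add: eta_def)
  obtain i j where ij: "i < j" and close: "\<forall>t<n. cmod (W j $ t - W i $ t) < eta"
    using unit_vec_seq_close_pair[OF W_unit eta] by blast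
  define d where "d = j - i"
  have "W d \<bullet>c psi - 1 = W j \<bullet>c W i - W i \<bullet>c W i"
    using cscalar_prod_funpow_unitary[OF V psi, of i d] W_unit[of i] ij
    by (simp add: W_def d_def unit_vec_in_def)
  also have "\<dots> = (W j - W i) \<bullet>c W i"
    using W_carrier by (simp add: minus_scalar_prod_distrib[of _ n])
  finally have "cmod (W d \<bullet>c psi - 1) = cmod ((W j - W i) \<bullet>c W i)" by simp
  also have "\<dots> \<le> real n * eta * 1"
    by (rule cmod_cscalar_prod_le) (use close W_carrier[of i] W_carrier[of j]
        in \<open>auto intro: less_imp_le unit_vec_in_index_le_1[OF W_unit]\<close>)
  also have "\<dots> \<le> (1 - lam) / 2"
    using lam by (simp add: eta_def field_simps)
  finally have "lam < overlap psi (W d)"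
    unfolding overlap_def using False lam by (intro less_cmod_squared_if_near_1) simp_all
  moreover have "d \<ge> 1" using ij by (simp add: d_def)
  ultimately show ?thesis unfolding W_def by force
qed

section \<open>Disturbing runs and pumping\<close>

fun qa_run :: "qa \<Rightarrow> (nat \<Rightarrow> nat) \<Rightarrow> nat \<Rightarrow> complex vec" where
  "qa_run A w 0 = qa_init A"
| "qa_run A w (Suc m) = qa_U A (w m) *\<^sub>v qa_run A w m"

lemma qa_run_cong:
  assumes "\<And>j. j < m \<Longrightarrow> w j = w' j"
  shows "qa_run A w m = qa_run A w' m"
  using assms by (induction m) auto

lemma drun_eq_qa_run_before_checkpoints:
  assumes "\<And>i. m \<le> ns i" and "j \<le> m"
  shows "drun A w psi ns j = qa_run A w j"
  using assms(2)
proof (induction j)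
  case (Suc j)
  have "j \<notin> range ns" using assms(1) Suc.prems by (metis Suc_le_eq not_le rangeE)
  then show ?case using Suc by simp
qed simp

lemma drun_after_checkpoint:
  assumes "m \<in> range ns" and "\<And>l. 0 < l \<Longrightarrow> l < j \<Longrightarrow> m + l \<notin> range ns"
    and "\<And>l. l < j \<Longrightarrow> w (m + l) = c" and "0 < j"
  shows "drun A w psi ns (m + j) = ((*\<^sub>v) (qa_U A c) ^^ j) psi"
  using assms(2-4)
proof (induction j)
  case (Suc j)
  show ?case
  proof (cases "j = 0")
    case True
    then show ?thesis using assms(1) Suc.prems(2)[of 0] by simp
  next
    case False
    then show ?thesis using Suc by simp
  qed
qed simp

lemma drun_unit_vec:
  assumes A: "is_qa Sg A" and w: "w \<in> omega_words Sg" and psi: "unit_vec_in (qa_dim A) psi"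
  shows "unit_vec_in (qa_dim A) (drun A w psi ns m)"
proof (induction m)
  case 0
  then show ?case using A by (simp add: is_qa_def)
next
  case (Suc m)
  have "unitary_mat (qa_dim A) (qa_U A (w m))"
    using A w by (auto simp: is_qa_def omega_words_def)
  then show ?case using unit_vec_in_unitary Suc psi by simp
qed

lemma fD_values_bdd_above:
  assumes A: "is_qa Sg A" and w: "w \<in> omega_words Sg"
  shows "bdd_above (fD_values A w)"
proof (rule bdd_aboveI)
  fix x assume "x \<in> fD_values A w"
  then obtain psi ns where x: "x = (INF i. overlap psi (drun A w psi ns (ns i)))"
    and psi: "unit_vec_in (qa_dim A) psi" unfolding fD_values_def by blast
  have "x \<le> overlap psi (drun A w psi ns (ns 0))"
    unfolding x by (rule cINF_lower) (auto intro: bdd_belowI overlap_nonneg)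
  also have "\<dots> \<le> (real (qa_dim A))\<^sup>2"
    by (rule overlap_le_dim_squared[OF drun_unit_vec[OF A w psi] psi])
  finally show "x \<le> (real (qa_dim A))\<^sup>2" .
qed

lemma lang_D_memI:
  assumes A: "is_qa Sg A" and w: "w \<in> omega_words Sg"
    and psi: "psi \<in> qa_F A" "unit_vec_in (qa_dim A) psi" and ns: "strict_mono ns"
    and "lam < b" and b_le: "\<And>i. b \<le> overlap psi (drun A w psi ns (ns i))"
  shows "w \<in> lang_D Sg lam A"
proof -
  have in_values: "(INF i. overlap psi (drun A w psi ns (ns i))) \<in> fD_values A w"
    unfolding fD_values_def using psi ns by blast
  have "b \<le> (INF i. overlap psi (drun A w psi ns (ns i)))"
    using b_le by (intro cINF_greatest) auto
  also have "\<dots> \<le> fD A w"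
    using in_values cSup_upper[OF in_values fD_values_bdd_above[OF A w]] by (auto simp: fD_def)
  finally show ?thesis using \<open>lam < b\<close> w by (simp add: lang_D_def)
qed

lemma lang_D_memE:
  assumes "w \<in> lang_D Sg lam A" and "0 \<le> lam"
  obtains psi ns where "psi \<in> qa_F A" "unit_vec_in (qa_dim A) psi" "strict_mono ns"
    "\<And>i. lam < overlap psi (drun A w psi ns (ns i))"
proof -
  have fD: "lam < fD A w" using assms(1) by (simp add: lang_D_def)
  then have "fD_values A w \<noteq> {}" using assms(2) by (auto simp: fD_def)
  then obtain x where "x \<in> fD_values A w" "lam < x"
    using fD less_cSupD by (auto simp: fD_def)
  then obtain psi ns where "psi \<in> qa_F A" "unit_vec_in (qa_dim A) psi" "strict_mono ns"
    and "lam < (INF i. overlap psi (drun A w psi ns (ns i)))"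
    unfolding fD_values_def by blast
  moreover have "(INF i. overlap psi (drun A w psi ns (ns i))) \<le> overlap psi (drun A w psi ns (ns i))" for i
    by (rule cINF_lower) (auto intro: bdd_belowI overlap_nonneg)
  ultimately show thesis using that less_le_trans by blast
qed

lemma lang_D_memI_periodic:
  assumes A: "is_qa Sg A" and w: "w \<in> omega_words Sg" and tail: "\<And>j. m \<le> j \<Longrightarrow> w j = c"
    and k: "1 \<le> k" and psi: "psi \<in> qa_F A" "unit_vec_in (qa_dim A) psi"
    and first: "lam < overlap psi (qa_run A w m)"
    and period: "lam < overlap psi (((*\<^sub>v) (qa_U A c) ^^ k) psi)"
  shows "w \<in> lang_D Sg lam A"
proof -
  define ns where "ns i = m + i * k" for i
  have ns: "strict_mono ns" unfolding ns_def using k by (intro strict_monoI) simp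
  have no_checkpoint: "ns i + l \<notin> range ns" if "0 < l" "l < k" for i l
  proof
    assume "ns i + l \<in> range ns"
    then obtain i' where "ns i + l = ns i'" by auto
    then have "i * k + l = i' * k" unfolding ns_def by linarith
    then have "l mod k = 0" by (metis mod_mult_self3 mod_mult_self2_is_0)
    then show False using that by simp
  qed
  let ?b = "min (overlap psi (qa_run A w m)) (overlap psi (((*\<^sub>v) (qa_U A c) ^^ k) psi))"
  have "?b \<le> overlap psi (drun A w psi ns (ns i))" for i
  proof (cases i)
    case 0
    have "drun A w psi ns m = qa_run A w m"
      by (rule drun_eq_qa_run_before_checkpoints[of m]) (auto simp: ns_def)
    then show ?thesis using 0 by (simp add: ns_def)
  next
    case (Suc i')
    have "drun A w psi ns (ns i' + k) = ((*\<^sub>v) (qa_U A c) ^^ k) psi"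
      using no_checkpoint k tail by (intro drun_after_checkpoint) (auto simp: ns_def)
    moreover have "ns i = ns i' + k" using Suc by (simp add: ns_def)
    ultimately show ?thesis by simp
  qed
  then show ?thesis
    using first period by (intro lang_D_memI[OF A w psi ns, of lam ?b]) auto
qed

lemma lang_D_pump:
  assumes A: "is_qa Sg A" and lam: "0 \<le> lam" "lam < 1"
    and w: "w \<in> lang_D Sg lam A" and c: "c \<in> Sg"
  shows "\<exists>n. (\<lambda>j. if j < n then w j else c) \<in> lang_D Sg lam A"
proof -
  obtain psi ns where psi: "psi \<in> qa_F A" "unit_vec_in (qa_dim A) psi" and ns: "strict_mono ns"
    and accept: "\<And>i. lam < overlap psi (drun A w psi ns (ns i))"
    using lang_D_memE[OF w lam(1)] by blast
  define n where "n = ns 0"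
  define w' where "w' j = (if j < n then w j else c)" for j
  have "drun A w psi ns n = qa_run A w n"
    using ns by (intro drun_eq_qa_run_before_checkpoints[of n]) (auto simp: n_def strict_mono_less_eq)
  also have "\<dots> = qa_run A w' n"
    by (rule qa_run_cong) (simp add: w'_def)
  finally have first: "lam < overlap psi (qa_run A w' n)"
    using accept[of 0] by (simp add: n_def)
  have "unitary_mat (qa_dim A) (qa_U A c)" using A c by (simp add: is_qa_def)
  then obtain k where k: "1 \<le> k" "lam < overlap psi (((*\<^sub>v) (qa_U A c) ^^ k) psi)"
    using unitary_recurrence psi(2) lam(2) by blast
  have "w' \<in> omega_words Sg"
    using w c by (auto simp: omega_words_def lang_D_def w'_def)
  then have "w' \<in> lang_D Sg lam A"
    using first k psi by (intro lang_D_memI_periodic[OF A _ _ k(1)]) (auto simp: w'_def)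
  then show ?thesis unfolding w'_def by blast
qed

section \<open>Two flip automata\<close>

definition pauli_X :: "complex mat" where
  "pauli_X = mat 2 2 (\<lambda>(i, j). if i = j then 0 else 1)"

text \<open>Started in \<open>e\<^sub>b\<close>, \<open>flip_qa b\<close> accepts exactly the words along which \<open>b\<close> plus the
  number of \<open>1\<close>s read is even infinitely often.\<close>

definition flip_qa :: "nat \<Rightarrow> qa" where
  "flip_qa b = \<lparr>qa_dim = 2, qa_init = unit_vec 2 b,
     qa_U = (\<lambda>l. if l = 1 then pauli_X else 1\<^sub>m 2), qa_F = {v \<in> carrier_vec 2. v $ 1 = 0}\<rparr>"

lemma pauli_X_mult_vec:
  assumes "v \<in> carrier_vec 2"
  shows "pauli_X *\<^sub>v v = vec 2 (\<lambda>i. v $ (1 - i))"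
  using assms
  by (intro eq_vecI) (auto simp: pauli_X_def scalar_prod_def atLeast0LessThan lessThan_nat_numeral)

lemma pauli_X_mult_unit_vec:
  assumes "b < 2"
  shows "pauli_X *\<^sub>v unit_vec 2 b = unit_vec 2 (1 - b)"
  using assms by (auto simp: pauli_X_mult_vec intro!: eq_vecI)

lemma unitary_pauli_X: "unitary_mat 2 pauli_X"
proof -
  have "cadj pauli_X = pauli_X" by (rule eq_matI) (auto simp: cadj_def pauli_X_def)
  moreover have "pauli_X * pauli_X = 1\<^sub>m 2"
    by (rule eq_matI) (auto simp: pauli_X_def scalar_prod_def atLeast0LessThan lessThan_nat_numeral)
  moreover have "pauli_X \<in> carrier_mat 2 2" by (simp add: pauli_X_def)
  ultimately show ?thesis by (simp add: unitary_mat_def)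
qed

lemma unitary_one_mat: "unitary_mat n (1\<^sub>m n)"
proof -
  have "cadj (1\<^sub>m n) = (1\<^sub>m n :: complex mat)" by (rule eq_matI) (auto simp: cadj_def)
  then show ?thesis by (simp add: unitary_mat_def)
qed

lemma is_qa_flip_qa: "b < 2 \<Longrightarrow> is_qa {0, 1} (flip_qa b)"
  by (auto simp: is_qa_def flip_qa_def unit_vec_in_def scalar_prod_def atLeast0LessThan
      lessThan_nat_numeral unitary_pauli_X unitary_one_mat subspace_of_def)

lemma lang_D_flip_qa_in_QBA_D_class:
  "b < 2 \<Longrightarrow> lang_D {0, 1} lam (flip_qa b) \<in> QBA_D_class {0, 1} lam"
  unfolding QBA_D_class_def using is_qa_flip_qa by blast

fun ones_count :: "(nat \<Rightarrow> nat) \<Rightarrow> nat \<Rightarrow> nat" where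
  "ones_count w 0 = 0"
| "ones_count w (Suc m) = ones_count w m + (if w m = 1 then 1 else 0)"

lemma ones_count_eq_if_zero_tail:
  assumes "\<And>j. n \<le> j \<Longrightarrow> w j = 0" and "n \<le> m"
  shows "ones_count w m = ones_count w n"
  using assms(2) by (induction m rule: dec_induct) (simp_all add: assms(1))

lemma ones_count_ones_prefix: "m \<le> n \<Longrightarrow> ones_count (\<lambda>j. if j < n then 1 else 0) m = m"
  by (induction m) auto

lemma qa_run_flip_qa:
  assumes w: "w \<in> omega_words {0, 1}" and b: "b < 2"
  shows "qa_run (flip_qa b) w m = unit_vec 2 ((ones_count w m + b) mod 2)"
proof (induction m)
  case 0
  then show ?case using b by (simp add: flip_qa_def)
next
  case (Suc m)
  have "w m = 0 \<or> w m = 1" using w by (auto simp: omega_words_def)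
  then show ?case
    using Suc by (auto simp: flip_qa_def pauli_X_mult_unit_vec mod_Suc)
qed

lemma flip_qa_accepts_eventually_ones:
  assumes w: "w \<in> omega_words {0, 1}" and b: "b < 2" and tail: "\<And>j. m \<le> j \<Longrightarrow> w j = 1"
    and lam: "lam < 1"
  shows "w \<in> lang_D {0, 1} lam (flip_qa b)"
proof -
  define m' where "m' = (if even (ones_count w m + b) then m else Suc m)"
  have e0: "unit_vec 2 0 \<in> qa_F (flip_qa b)" "unit_vec_in (qa_dim (flip_qa b)) (unit_vec 2 0)"
    by (auto simp: flip_qa_def unit_vec_in_def scalar_prod_def atLeast0LessThan lessThan_nat_numeral)
  have "overlap (unit_vec 2 0) (unit_vec 2 0) = 1"
    by (simp add: overlap_def scalar_prod_def atLeast0LessThan lessThan_nat_numeral)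
  moreover have "qa_run (flip_qa b) w m' = unit_vec 2 0"
    using tail[of m] by (auto simp: m'_def qa_run_flip_qa[OF w b] mod_Suc)
  moreover have "((*\<^sub>v) (qa_U (flip_qa b) 1) ^^ Suc (Suc 0)) (unit_vec 2 0) = unit_vec 2 0"
    by (simp add: flip_qa_def pauli_X_mult_unit_vec)
  ultimately show ?thesis
    using tail lam
    by (intro lang_D_memI_periodic[OF is_qa_flip_qa[OF b] w _ _ e0,
          where m = m' and c = 1 and k = "Suc (Suc 0)"]) (auto simp: m'_def split: if_splits)
qed

lemma drun_flip_qa_carrier:
  assumes "b < 2" and "psi \<in> qa_F (flip_qa b)"
  shows "drun (flip_qa b) w psi ns m \<in> carrier_vec 2"
  using assms by (induction m) (auto simp: flip_qa_def pauli_X_mult_vec)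

text \<open>While no checkpoint state is orthogonal to \<open>e\<^sub>0\<close>, every reset happens in the basis state
  of the undisturbed run, so the disturbed run stays on that basis state
  \<open>e\<^bsub>(ones_count w m + b) mod 2\<^esub>\<close>.\<close>

lemma drun_flip_qa_zero_index:
  assumes w: "w \<in> omega_words {0, 1}" and b: "b < 2" and psi: "psi \<in> qa_F (flip_qa b)"
    and live: "\<And>i. ns i < m \<Longrightarrow> drun (flip_qa b) w psi ns (ns i) $ 0 \<noteq> 0"
  shows "drun (flip_qa b) w psi ns m $ (if even (ones_count w m + b) then 1 else 0) = 0"
  using live
proof (induction m)
  case 0
  then show ?case using b by (auto simp: flip_qa_def less_2_cases_iff)
next
  case (Suc m)
  have IH: "drun (flip_qa b) w psi ns m $ (if even (ones_count w m + b) then 1 else 0) = 0"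
    using Suc by simp
  have carrier: "drun (flip_qa b) w psi ns m \<in> carrier_vec 2" "psi \<in> carrier_vec 2" "psi $ 1 = 0"
    using drun_flip_qa_carrier[OF b psi] psi by (auto simp: flip_qa_def)
  have letter: "w m = 0 \<or> w m = 1" using w by (auto simp: omega_words_def)
  show ?case
  proof (cases "m \<in> range ns")
    case True
    then have "drun (flip_qa b) w psi ns m $ 0 \<noteq> 0" using Suc.prems by auto
    then have "even (ones_count w m + b)" using IH by (auto split: if_splits)
    then show ?thesis using True letter carrier by (auto simp: flip_qa_def pauli_X_mult_vec)
  next
    case False
    then show ?thesis using IH letter carrier by (auto simp: flip_qa_def pauli_X_mult_vec)
  qed
qed

lemma flip_qa_rejects_eventually_zeros:
  assumes w: "w \<in> omega_words {0, 1}" and b: "b < 2" and tail: "\<And>j. n \<le> j \<Longrightarrow> w j = 0"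
    and odd: "odd (ones_count w n + b)" and lam: "0 \<le> lam"
  shows "w \<notin> lang_D {0, 1} lam (flip_qa b)"
proof
  assume "w \<in> lang_D {0, 1} lam (flip_qa b)"
  then obtain psi ns where psi: "psi \<in> qa_F (flip_qa b)" and ns: "strict_mono ns"
    and accept: "\<And>i. lam < overlap psi (drun (flip_qa b) w psi ns (ns i))"
    using lang_D_memE lam by metis
  have live: "drun (flip_qa b) w psi ns (ns i) $ 0 \<noteq> 0" for i
  proof
    assume "drun (flip_qa b) w psi ns (ns i) $ 0 = 0"
    then have "overlap psi (drun (flip_qa b) w psi ns (ns i)) = 0"
      using drun_flip_qa_carrier[OF b psi] psi
      by (auto simp: overlap_def flip_qa_def scalar_prod_def atLeast0LessThan lessThan_nat_numeral)
    then show False using accept[of i] lam by simp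
  qed
  have "ones_count w (ns n) = ones_count w n"
    using tail seq_suble[OF ns] by (rule ones_count_eq_if_zero_tail)
  then have "drun (flip_qa b) w psi ns (ns n) $ 0 = 0"
    using drun_flip_qa_zero_index[OF w b psi, of ns "ns n"] live odd by auto
  then show False using live by blast
qed

lemma flip_qa_Int_notin_QBA_D_class:
  assumes lam: "0 \<le> lam" "lam < 1"
  shows "lang_D {0, 1} lam (flip_qa 0) \<inter> lang_D {0, 1} lam (flip_qa 1) \<notin> QBA_D_class {0, 1} lam"
proof
  let ?L = "\<lambda>b. lang_D {0, 1} lam (flip_qa b)"
  assume "?L 0 \<inter> ?L 1 \<in> QBA_D_class {0, 1} lam"
  then obtain B where B: "is_qa {0, 1} B" and eq: "?L 0 \<inter> ?L 1 = lang_D {0, 1} lam B"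
    unfolding QBA_D_class_def by auto
  have ones: "(\<lambda>_. 1) \<in> omega_words {0, 1}" by (simp add: omega_words_def)
  have "(\<lambda>_. 1) \<in> ?L b" if "b < 2" for b
    using flip_qa_accepts_eventually_ones[OF ones that _ lam(2), of 0] by simp
  then have "(\<lambda>_. 1) \<in> lang_D {0, 1} lam B" unfolding eq[symmetric] by simp
  then obtain n where "(\<lambda>j. if j < n then 1 else 0) \<in> lang_D {0, 1} lam B"
    using lang_D_pump[OF B lam, of "\<lambda>_. 1" 0] by auto
  then have y: "(\<lambda>j. if j < n then 1 else 0) \<in> ?L 0 \<inter> ?L 1" unfolding eq .
  define b where "b = (if odd n then 0 else 1 :: nat)"
  have "ones_count (\<lambda>j. if j < n then 1 else 0) n = n"
    by (rule ones_count_ones_prefix) simp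
  moreover have "odd (n + b)" by (simp add: b_def)
  ultimately have "(\<lambda>j. if j < n then 1 else 0) \<notin> ?L b"
    using lam(1)
    by (intro flip_qa_rejects_eventually_zeros[where n = n]) (auto simp: omega_words_def b_def)
  then show False using y by (cases "odd n") (simp_all add: b_def)
qed

lemma flip_qa_complement_notin_QBA_D_class:
  assumes lam: "0 \<le> lam" "lam < 1"
  shows "omega_words {0, 1} - lang_D {0, 1} lam (flip_qa 0) \<notin> QBA_D_class {0, 1} lam"
proof
  let ?L = "lang_D {0, 1} lam (flip_qa 0)"
  assume "omega_words {0, 1} - ?L \<in> QBA_D_class {0, 1} lam"
  then obtain B where B: "is_qa {0, 1} B" and eq: "omega_words {0, 1} - ?L = lang_D {0, 1} lam B"
    unfolding QBA_D_class_def by auto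
  define w :: "nat \<Rightarrow> nat" where "w j = (if j = 0 then 1 else 0)" for j
  have w: "w \<in> omega_words {0, 1}" by (simp add: w_def omega_words_def)
  have "w \<notin> ?L"
    using lam(1) by (intro flip_qa_rejects_eventually_zeros[OF w, where n = 1]) (auto simp: w_def)
  then have "w \<in> lang_D {0, 1} lam B" using w unfolding eq[symmetric] by blast
  then obtain n where "(\<lambda>j. if j < n then w j else 1) \<in> lang_D {0, 1} lam B"
    using lang_D_pump[OF B lam, of w 1] by auto
  then have y: "(\<lambda>j. if j < n then w j else 1) \<in> omega_words {0, 1} - ?L" unfolding eq .
  moreover have "(\<lambda>j. if j < n then w j else 1) \<in> ?L"
    using y lam(2) by (intro flip_qa_accepts_eventually_ones[where m = n]) auto
  ultimately show False by blast
qed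

theorem theorem11:
  fixes lam :: real
  assumes "0 \<le> lam" and "lam < 1"
  shows "(\<exists>Sg. finite Sg \<and> (\<exists>L1\<in>QBA_D_class Sg lam. \<exists>L2\<in>QBA_D_class Sg lam.
            L1 \<inter> L2 \<notin> QBA_D_class Sg lam))
       \<and> (\<exists>Sg. finite Sg \<and> (\<exists>L\<in>QBA_D_class Sg lam.
            omega_words Sg - L \<notin> QBA_D_class Sg lam))"
proof (intro conjI exI[of _ "{0, 1}"])
  have in_class: "lang_D {0, 1} lam (flip_qa 0) \<in> QBA_D_class {0, 1} lam"
    "lang_D {0, 1} lam (flip_qa 1) \<in> QBA_D_class {0, 1} lam"
    by (rule lang_D_flip_qa_in_QBA_D_class, simp)+
  show "\<exists>L1\<in>QBA_D_class {0, 1} lam. \<exists>L2\<in>QBA_D_class {0, 1} lam. L1 \<inter> L2 \<notin> QBA_D_class {0, 1} lam"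
    using flip_qa_Int_notin_QBA_D_class[OF assms] in_class by blast
  show "\<exists>L\<in>QBA_D_class {0, 1} lam. omega_words {0, 1} - L \<notin> QBA_D_class {0, 1} lam"
    using flip_qa_complement_notin_QBA_D_class[OF assms] in_class by blast
qed simp_all

end
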